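(* Let $V$ be a $\mathbb{Q}$-vector space of finite dimension $n\ge 2$, let $B:V\times V\to\mathbb{Q}$ be a non-degenerate symmetric bilinear form, and let $\Lambda\subset V$ be a lattice with $B(v,v')\in\mathbb{Z}$ for all $v,v'\in\Lambda$. Let $w\in\Lambda\setminus\{0\}$ with $B(w,w)\neq 0$. Suppose that $B'$ is a non-degenerate symmetric bilinear form on $V$ and that $B'=B_\phi$ for some $\phi\in\mathrm{GL}(\Lambda)$. Write $$\phi=\phi_0+\frac{\mathrm{wt}(\phi)_{B,w}}{B(w,w)}\phi_{B,w,w}+\phi_{B,w,a}+\phi_{B,b,w}$$ with $a,b\in\{w\}_B^\perp$ and $\phi_0\in E^{(0)}(B,w)$ of weight $0$. Then the vectors $\tilde a=B(w,w)^2a\in\Lambda^*$ and $\tilde b=B(w,w)^2b\in\Lambda$ satisfy $$B(w,w)^2B'(w,w)=B(w,w)B(w,\phi(w))^2+B(\tilde b,\tilde b),$$ $$B(w,w)^3B'(w,z)=B(w,w)B(w,\phi(w))B(\tilde a,z_0)+B(\tilde b,\tilde\phi_0(z_0)),$$ $$B(w,w)^4B'(z,z)=B(\tilde\phi_0(z_0),\tilde\phi_0(z_0))+B(w,w)B(\tilde a,z_0)^2,$$ for any $z_0\in\Lambda$, where $z=z_0-\frac{B(z_0,w)}{B(w,w)}w\in\{w\}_B^\perp$ and $\tilde\phi_0(z_0)=B(w,w)^2\phi_0(z_0)\in\Lambda$.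
   Context: A lattice $\Lambda\subset V$ is a $\mathbb{Z}$-submodule with $\mathbb{Q}\Lambda=V$. Its dual is $\Lambda^*=\{v\in V : B(u,v)\in\mathbb{Z}\text{ for all }u\in\Lambda\}$, and $\mathrm{GL}(\Lambda)=\{\phi\in\mathrm{GL}(V) : \phi(\Lambda)=\Lambda\}$. Write $\{w\}_B^\perp=\{u\in V : B(u,w)=0\}$ and $$E^{(0)}(B,w)=\{\phi\in\mathrm{End}_{\mathbb{Q}}(V) : B(u,\phi(w))=B(w,\phi(u))=0 \text{ for all } u\in\{w\}_B^\perp\}.$$ The weight of an endomorphism $\phi$ is $\mathrm{wt}(\phi)_{B,w}=B(w,\phi(w))/B(w,w)$. For $u,v\in V$, $\phi_{B,u,v}\in\mathrm{End}_{\mathbb{Q}}(V)$ is defined by $\phi_{B,u,v}(x)=B(v,x)u$. For $\phi\in\mathrm{End}_{\mathbb{Q}}(V)$, $B_\phi(x,y)=B(\phi(x),\phi(y))$. Every $\phi\in\mathrm{End}_{\mathbb{Q}}(V)$ has a (unique) decomposition of the displayed form. *)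

theory Defs
  imports Complex_Main
begin

text \<open>
  A rational vector space is a type \<open>'v\<close> whose scalar multiplication \<open>scale\<close> is passed
  explicitly, as in the library's locale \<open>vector_space\<close>; \<open>V\<close> is the whole type.
\<close>

definition bilinear_form ::
    "(rat \<Rightarrow> 'v::ab_group_add \<Rightarrow> 'v) \<Rightarrow> ('v \<Rightarrow> 'v \<Rightarrow> rat) \<Rightarrow> bool" where
  "bilinear_form scale B \<longleftrightarrow>
     (\<forall>x. Vector_Spaces.linear scale (*) (\<lambda>y. B x y)) \<and>
     (\<forall>y. Vector_Spaces.linear scale (*) (\<lambda>x. B x y))"

definition symmetric_form :: "('v \<Rightarrow> 'v \<Rightarrow> rat) \<Rightarrow> bool" where
  "symmetric_form B \<longleftrightarrow> (\<forall>x y. B x y = B y x)"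

text \<open>Only the left radical is required to vanish; this is used for symmetric forms only.\<close>

definition nondegenerate_form :: "('v::zero \<Rightarrow> 'v \<Rightarrow> rat) \<Rightarrow> bool" where
  "nondegenerate_form B \<longleftrightarrow> (\<forall>x. (\<forall>y. B x y = 0) \<longrightarrow> x = 0)"

text \<open>
  Finite generation is not part of the definition. It is automatic as soon as a non-degenerate
  form on a finite-dimensional space is integral on \<open>L\<close>.
\<close>

definition is_lattice ::
    "(rat \<Rightarrow> 'v::ab_group_add \<Rightarrow> 'v) \<Rightarrow> 'v set \<Rightarrow> bool" where
  "is_lattice scale L \<longleftrightarrow>
     0 \<in> L \<and> (\<forall>x\<in>L. \<forall>y\<in>L. x + y \<in> L) \<and> (\<forall>k::int. \<forall>x\<in>L. scale (of_int k) x \<in> L) \<and>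
     module.span scale L = UNIV"

definition dual_lattice :: "('v \<Rightarrow> 'v \<Rightarrow> rat) \<Rightarrow> 'v set \<Rightarrow> 'v set" where
  "dual_lattice B L = {v. \<forall>u\<in>L. B u v \<in> \<int>}"

definition Endo ::
    "(rat \<Rightarrow> 'v::ab_group_add \<Rightarrow> 'v) \<Rightarrow> ('v \<Rightarrow> 'v) set" where
  "Endo scale = {\<phi>. Vector_Spaces.linear scale scale \<phi>}"

definition GL_lattice ::
    "(rat \<Rightarrow> 'v::ab_group_add \<Rightarrow> 'v) \<Rightarrow> 'v set \<Rightarrow> ('v \<Rightarrow> 'v) set" where
  "GL_lattice scale L = {\<phi> \<in> Endo scale. bij \<phi> \<and> \<phi> ` L = L}"

definition perp :: "('v \<Rightarrow> 'v \<Rightarrow> rat) \<Rightarrow> 'v \<Rightarrow> 'v set" where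
  "perp B w = {u. B u w = 0}"

definition E0 ::
    "(rat \<Rightarrow> 'v::ab_group_add \<Rightarrow> 'v) \<Rightarrow> ('v \<Rightarrow> 'v \<Rightarrow> rat) \<Rightarrow> 'v \<Rightarrow> ('v \<Rightarrow> 'v) set" where
  "E0 scale B w = {\<phi> \<in> Endo scale. \<forall>u\<in>perp B w. B u (\<phi> w) = 0 \<and> B w (\<phi> u) = 0}"

definition wt :: "('v \<Rightarrow> 'v \<Rightarrow> rat) \<Rightarrow> 'v \<Rightarrow> ('v \<Rightarrow> 'v) \<Rightarrow> rat" where
  "wt B w \<phi> = B w (\<phi> w) / B w w"

definition rank_one ::
    "(rat \<Rightarrow> 'v \<Rightarrow> 'v) \<Rightarrow> ('v \<Rightarrow> 'v \<Rightarrow> rat) \<Rightarrow> 'v \<Rightarrow> 'v \<Rightarrow> 'v \<Rightarrow> 'v" where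
  "rank_one scale B u v = (\<lambda>x. scale (B v x) u)"

definition pullback_form :: "('v \<Rightarrow> 'v \<Rightarrow> rat) \<Rightarrow> ('v \<Rightarrow> 'v) \<Rightarrow> 'v \<Rightarrow> 'v \<Rightarrow> rat" where
  "pullback_form B \<phi> = (\<lambda>x y. B (\<phi> x) (\<phi> y))"

end

theory Submission
  imports Defs
begin

text \<open>
  Since \<open>B w w \<noteq> 0\<close>, the space is the orthogonal sum of the line through \<open>w\<close> and its complement.
  A weight-zero element \<open>\<phi>\<^sub>0\<close> of \<open>E\<^sup>(\<^sup>0\<^sup>)\<close> lives on the complement: it kills \<open>w\<close>
  (\<open>weight_zero_kills_w\<close>), by non-degeneracy, and its image is orthogonal to \<open>w\<close>
  (\<open>w_orthogonal_image\<close>). So in block form relative to this sum, \<open>\<phi>\<close> has the scalar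
  \<open>B w (\<phi> w) / B w w\<close>, the row \<open>a\<close>, the column \<open>b\<close> and the block \<open>\<phi>\<^sub>0\<close>.

  Write \<open>a'\<close>, \<open>b'\<close>, \<open>\<phi>\<^sub>0'\<close> for \<open>a\<close>, \<open>b\<close>, \<open>\<phi>\<^sub>0\<close> scaled by \<open>(B w w)\<^sup>2\<close>. Reading off the blocks
  expresses \<open>b'\<close>, \<open>B x a'\<close> and \<open>\<phi>\<^sub>0' x\<close> by \<open>\<phi> w\<close>, \<open>\<phi> x\<close>, \<open>w\<close> and values of \<open>B\<close>; the factor \<open>(B w w)\<^sup>2\<close> is what clears
  all denominators, and these formulas (\<open>scaled_column\<close>, \<open>scaled_row\<close>, \<open>scaled_block\<close>)
  give integrality. The three identities are Pythagoras: with \<open>z\<close> the projection of \<open>z\<^sub>0\<close>, the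
  images \<open>\<phi> w\<close> and \<open>\<phi> z\<close> are sums of a multiple of \<open>w\<close> and a vector orthogonal to \<open>w\<close>
  (\<open>image_w\<close>, \<open>image_projection\<close>), so \<open>B'\<close> on them splits without cross terms.
\<close>

lemma bilinear_form_vector_space:
  assumes "bilinear_form scale B"
  shows "vector_space scale"
  using assms unfolding bilinear_form_def Vector_Spaces.linear_def by blast

lemma bilinear_form_simps:
  assumes "bilinear_form scale B"
  shows "B (x + y) z = B x z + B y z" "B z (x + y) = B z x + B z y"
    "B (scale c x) z = c * B x z" "B z (scale c x) = c * B z x"
    "B (x - y) z = B x z - B y z" "B z (x - y) = B z x - B z y"
proof -
  have l: "module_hom scale (*) (\<lambda>y. B x y)" and r: "module_hom scale (*) (\<lambda>x. B x y)" for x y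
    using assms unfolding bilinear_form_def by (auto simp: linear_iff_module_hom)
  show "B (x + y) z = B x z + B y z" "B z (x + y) = B z x + B z y"
    "B (scale c x) z = c * B x z" "B z (scale c x) = c * B z x"
    "B (x - y) z = B x z - B y z" "B z (x - y) = B z x - B z y"
    using module_hom.add[OF l] module_hom.add[OF r] module_hom.scale[OF l] module_hom.scale[OF r]
      module_hom.diff[OF l] module_hom.diff[OF r] by auto
qed

lemma lattice_closed:
  assumes "is_lattice scale L" "vector_space scale" "x \<in> L"
  shows "y \<in> L \<Longrightarrow> x + y \<in> L" "k \<in> \<int> \<Longrightarrow> scale k x \<in> L" "y \<in> L \<Longrightarrow> x - y \<in> L"
proof -
  interpret vector_space scale by fact
  show sum: "x + y \<in> L" if "y \<in> L" for y
    using assms that unfolding is_lattice_def by blast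
  have scaled: "scale k u \<in> L" if "k \<in> \<int>" "u \<in> L" for k u
    using assms(1) that unfolding is_lattice_def by (auto elim!: Ints_cases)
  show "k \<in> \<int> \<Longrightarrow> scale k x \<in> L"
    using scaled assms(3) by blast
  show "x - y \<in> L" if "y \<in> L"
    using sum[of "scale (- 1) y"] scaled[of "- 1" y] that by simp
qed

locale anisotropic_vector =
  fixes scale :: "rat \<Rightarrow> 'v::ab_group_add \<Rightarrow> 'v" and B :: "'v \<Rightarrow> 'v \<Rightarrow> rat" and w :: 'v
  assumes bilinear: "bilinear_form scale B"
    and symmetric: "symmetric_form B"
    and nonisotropic: "B w w \<noteq> 0"
begin

sublocale vector_space scale
  by (rule bilinear_form_vector_space[OF bilinear])

lemmas B_simps = bilinear_form_simps[OF bilinear]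

lemma B_commute: "B x y = B y x"
  using symmetric unfolding symmetric_form_def by blast

lemma projection_in_perp: "x - scale (B x w / B w w) w \<in> perp B w"
  using nonisotropic by (simp add: perp_def B_simps)

text \<open>
  The weight condition supplies orthogonality of \<open>\<phi>\<^sub>0 w\<close> to \<open>w\<close>, membership in \<open>E\<^sup>(\<^sup>0\<^sup>)\<close>
  orthogonality to the complement. The line through \<open>w\<close> and the complement together span.
\<close>

lemma weight_zero_kills_w:
  assumes "nondegenerate_form B" "\<phi>\<^sub>0 \<in> E0 scale B w" "wt B w \<phi>\<^sub>0 = 0"
  shows "\<phi>\<^sub>0 w = 0"
proof -
  have "B w (\<phi>\<^sub>0 w) = 0"
    using assms(3) nonisotropic by (simp add: wt_def)
  moreover have "B (x - scale (B x w / B w w) w) (\<phi>\<^sub>0 w) = 0" for x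
    using assms(2) projection_in_perp unfolding E0_def by blast
  ultimately have "B x (\<phi>\<^sub>0 w) = 0" for x
    by (simp add: B_simps)
  then show ?thesis
    using assms(1) unfolding nondegenerate_form_def by (simp add: B_commute)
qed

end

text \<open>
  The coefficient of the component along \<open>w\<close> is an arbitrary \<open>c\<close>; \<open>coefficient\<close> below shows
  that the decomposition forces it to be \<open>wt B w \<phi> / B w w\<close>.
\<close>

locale decomposed_endomorphism = anisotropic_vector scale B w
  for scale :: "rat \<Rightarrow> 'v::ab_group_add \<Rightarrow> 'v" and B :: "'v \<Rightarrow> 'v \<Rightarrow> rat" and w :: 'v +
  fixes \<phi> \<phi>\<^sub>0 :: "'v \<Rightarrow> 'v" and a b :: 'v and c :: rat
  assumes nondegenerate: "nondegenerate_form B"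
    and a_perp: "a \<in> perp B w" and b_perp: "b \<in> perp B w"
    and E0: "\<phi>\<^sub>0 \<in> E0 scale B w" and weight_zero: "wt B w \<phi>\<^sub>0 = 0"
    and decomposition: "\<phi> x = \<phi>\<^sub>0 x + scale c (rank_one scale B w w x)
          + rank_one scale B w a x + rank_one scale B b w x"
begin

lemma orthogonal [simp]: "B a w = 0" "B w a = 0" "B b w = 0" "B w b = 0"
  using a_perp b_perp B_commute unfolding perp_def by auto

lemma kills_w [simp]: "\<phi>\<^sub>0 w = 0"
  by (rule weight_zero_kills_w[OF nondegenerate E0 weight_zero])

lemma block_projection: "\<phi>\<^sub>0 (x - scale r w) = \<phi>\<^sub>0 x"
proof -
  have "module_hom scale scale \<phi>\<^sub>0"
    using E0 unfolding E0_def Endo_def by (simp add: linear_iff_module_hom)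
  then show ?thesis
    by (simp add: module_hom.diff module_hom.scale)
qed

lemma w_orthogonal_image [simp]: "B w (\<phi>\<^sub>0 x) = 0" "B (\<phi>\<^sub>0 x) w = 0"
proof -
  have "B w (\<phi>\<^sub>0 (x - scale (B x w / B w w) w)) = 0"
    using E0 projection_in_perp unfolding E0_def by blast
  then show "B w (\<phi>\<^sub>0 x) = 0"
    by (simp add: block_projection)
  then show "B (\<phi>\<^sub>0 x) w = 0"
    by (simp add: B_commute)
qed

lemma apply_decomposition:
  "\<phi> x = \<phi>\<^sub>0 x + scale (c * B w x + B a x) w + scale (B w x) b"
  by (simp add: decomposition rank_one_def scale_left_distrib add.assoc)

lemma coefficient: "c * (B w w)\<^sup>2 = B w (\<phi> w)"
  by (simp add: apply_decomposition B_simps power2_eq_square)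

lemma image_w: "\<phi> w = scale (c * B w w) w + scale (B w w) b"
  by (simp add: apply_decomposition)

lemma image_projection:
  "\<phi> (x - scale (B x w / B w w) w) = \<phi>\<^sub>0 x + scale (B a x) w"
  using nonisotropic by (simp add: apply_decomposition block_projection B_simps B_commute[of w x])

lemma scaled_column:
  "scale ((B w w)\<^sup>2) b = scale (B w w) (\<phi> w) - scale (B w (\<phi> w)) w"
  by (simp add: image_w B_simps scale_right_distrib power2_eq_square mult.commute mult.left_commute)

lemma scaled_row:
  "B x (scale ((B w w)\<^sup>2) a) = B w w * B w (\<phi> x) - B w (\<phi> w) * B w x"
  by (simp add: apply_decomposition B_simps power2_eq_square algebra_simps B_commute[of x a])

lemma scaled_block:
  "scale ((B w w)\<^sup>2) (\<phi>\<^sub>0 x) = scale ((B w w)\<^sup>2) (\<phi> x)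
     - scale (B w (\<phi> w) * B w x + B x (scale ((B w w)\<^sup>2) a)) w
     - scale (B w x) (scale ((B w w)\<^sup>2) b)"
  by (simp add: apply_decomposition[of x] coefficient[symmetric] B_simps scale_right_distrib
      scale_left_distrib B_commute[of x a] algebra_simps)

lemma pullback_w_w:
  "(B w w)\<^sup>2 * pullback_form B \<phi> w w = B w w * (B w (\<phi> w))\<^sup>2
     + B (scale ((B w w)\<^sup>2) b) (scale ((B w w)\<^sup>2) b)"
  by (simp add: pullback_form_def image_w B_simps power2_eq_square algebra_simps)

lemma pullback_w_projection:
  "(B w w)^3 * pullback_form B \<phi> w (x - scale (B x w / B w w) w)
     = B w w * B w (\<phi> w) * B (scale ((B w w)\<^sup>2) a) x
       + B (scale ((B w w)\<^sup>2) b) (scale ((B w w)\<^sup>2) (\<phi>\<^sub>0 x))"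
  unfolding pullback_form_def image_projection image_w
  by (simp add: B_simps power2_eq_square power3_eq_cube algebra_simps)

lemma pullback_projection:
  "(B w w)^4 * pullback_form B \<phi> (x - scale (B x w / B w w) w) (x - scale (B x w / B w w) w)
     = B (scale ((B w w)\<^sup>2) (\<phi>\<^sub>0 x)) (scale ((B w w)\<^sup>2) (\<phi>\<^sub>0 x))
       + B w w * (B (scale ((B w w)\<^sup>2) a) x)\<^sup>2"
  unfolding pullback_form_def image_projection
  by (simp add: B_simps power2_eq_square power4_eq_xxxx algebra_simps)

text \<open>\<open>scaled_row\<close> and \<open>scaled_column\<close> come first: the coefficients in \<open>scaled_block\<close> and its
  last vector are integral only because \<open>B x a'\<close> and \<open>b'\<close> already are.\<close>

lemma components_integral:
  assumes "is_lattice scale L" "\<forall>u\<in>L. \<forall>v\<in>L. B u v \<in> \<int>" "w \<in> L" "\<phi> ` L \<subseteq> L"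
  shows "scale ((B w w)\<^sup>2) a \<in> dual_lattice B L" "scale ((B w w)\<^sup>2) b \<in> L"
    "x \<in> L \<Longrightarrow> scale ((B w w)\<^sup>2) (\<phi>\<^sub>0 x) \<in> L"
proof -
  note closed = lattice_closed[OF assms(1) vector_space_axioms]
  have image: "\<phi> u \<in> L" if "u \<in> L" for u
    using assms(4) that by blast
  have integral: "B u v \<in> \<int>" if "u \<in> L" "v \<in> L" for u v
    using assms(2) that by blast
  have row: "B u (scale ((B w w)\<^sup>2) a) \<in> \<int>" if "u \<in> L" for u
    unfolding scaled_row by (intro Ints_diff Ints_mult integral image assms(3) that)
  then show "scale ((B w w)\<^sup>2) a \<in> dual_lattice B L"
    unfolding dual_lattice_def by blast
  show column: "scale ((B w w)\<^sup>2) b \<in> L"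
    unfolding scaled_column by (intro closed integral image assms(3))
  show "scale ((B w w)\<^sup>2) (\<phi>\<^sub>0 x) \<in> L" if "x \<in> L"
    unfolding scaled_block
    by (intro closed column row Ints_add Ints_mult Ints_power integral image assms(3) that)
qed

end

theorem corollary4p2:
  fixes scale :: "rat \<Rightarrow> 'v::ab_group_add \<Rightarrow> 'v"
    and Basis :: "'v set"
    and n :: nat
    and B B' :: "'v \<Rightarrow> 'v \<Rightarrow> rat"
    and \<Lambda> :: "'v set"
    and w a b :: 'v
    and \<phi> \<phi>\<^sub>0 :: "'v \<Rightarrow> 'v"
  assumes "finite_dimensional_vector_space scale Basis"
    and "vector_space.dim scale (UNIV :: 'v set) = n" and "n \<ge> 2"
    and "bilinear_form scale B" and "symmetric_form B" and "nondegenerate_form B"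
    and "is_lattice scale \<Lambda>" and "\<forall>v\<in>\<Lambda>. \<forall>v'\<in>\<Lambda>. B v v' \<in> \<int>"
    and "w \<in> \<Lambda> - {0}" and "B w w \<noteq> 0"
    and "bilinear_form scale B'" and "symmetric_form B'" and "nondegenerate_form B'"
    and "\<phi> \<in> GL_lattice scale \<Lambda>" and "B' = pullback_form B \<phi>"
    and "a \<in> perp B w" and "b \<in> perp B w"
    and "\<phi>\<^sub>0 \<in> E0 scale B w" and "wt B w \<phi>\<^sub>0 = 0"
    and "\<phi> = (\<lambda>x. \<phi>\<^sub>0 x + scale (wt B w \<phi> / B w w) (rank_one scale B w w x)
                 + rank_one scale B w a x + rank_one scale B b w x)"
  shows "let a' = scale ((B w w)\<^sup>2) a;
             b' = scale ((B w w)\<^sup>2) b;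
             \<phi>\<^sub>0' = (\<lambda>x. scale ((B w w)\<^sup>2) (\<phi>\<^sub>0 x))
         in a' \<in> dual_lattice B \<Lambda> \<and> b' \<in> \<Lambda> \<and>
            (B w w)\<^sup>2 * B' w w = B w w * (B w (\<phi> w))\<^sup>2 + B b' b' \<and>
            (\<forall>z\<^sub>0\<in>\<Lambda>.
               let z = z\<^sub>0 - scale (B z\<^sub>0 w / B w w) w
               in z \<in> perp B w \<and> \<phi>\<^sub>0' z\<^sub>0 \<in> \<Lambda> \<and>
                  (B w w)^3 * B' w z = B w w * B w (\<phi> w) * B a' z\<^sub>0 + B b' (\<phi>\<^sub>0' z\<^sub>0) \<and>
                  (B w w)^4 * B' z z = B (\<phi>\<^sub>0' z\<^sub>0) (\<phi>\<^sub>0' z\<^sub>0) + B w w * (B a' z\<^sub>0)\<^sup>2)"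
proof -
  interpret decomposed_endomorphism scale B w \<phi> \<phi>\<^sub>0 a b "wt B w \<phi> / B w w"
  proof unfold_locales
    show "\<phi> x = \<phi>\<^sub>0 x + scale (wt B w \<phi> / B w w) (rank_one scale B w w x)
        + rank_one scale B w a x + rank_one scale B b w x" for x
      (* The hypothesis has \<phi> on both sides, so rewriting with it would not end. *)
      by (rule fun_cong[OF assms(20)])
  qed (use assms in blast)+
  have "w \<in> \<Lambda>" "\<phi> ` \<Lambda> \<subseteq> \<Lambda>"
    using assms(9,14) by (auto simp: GL_lattice_def)
  note integral = components_integral[OF assms(7,8) this]
  show ?thesis
    unfolding Let_def assms(15)
    using integral projection_in_perp pullback_w_w pullback_w_projection pullback_projection
    by blast
qed

end
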